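(* Let $\gamma=2$. Let $u_0\equiv 0$ and let $u_1\in C(\mathbb{R}^3)$ satisfy, for some constant $B>0$, $$u_1(x)\ge\frac{B}{(1+|x|)^{5/2}}\quad\text{for } |x|\ge1.$$ Then there exist $C>0$ and $\varepsilon_0=\varepsilon_0(u_1)>0$ such that for every $\varepsilon\in(0,\varepsilon_0]$ the lifespan $T(\varepsilon)$ of solutions to $$\partial_t^2u-\Delta u=(V_2*u^2)u \ \text{ on } \mathbb{R}^3\times[0,T),\qquad u(x,0)=0,\quad \partial_tu(x,0)=\varepsilon u_1(x),$$ satisfies $$T(\varepsilon)\le \exp(C\varepsilon^{-2}).$$
   Context: $V_2(x)=|x|^{-2}$ on $\mathbb{R}^3$, and $*$ denotes convolution in the space variables. Wave operators: for $\phi\in C(\mathbb{R}^3)$, $W(\phi|x,t):=\frac{t}{4\pi}\int_{|\omega|=1}\phi(x+t\omega)\,dS_\omega$, and for $F$ continuous in $(x,t)$, $L(F)(x,t):=\int_0^tW(F(\cdot,s)|x,t-s)\,ds$. Solution: a solution on $\mathbb{R}^3\times[0,T)$ of the Cauchy problem with initial data $(f,g)\in C^1(\mathbb{R}^3)\times C(\mathbb{R}^3)$ (meaning $u(x,0)=f(x)$, $\partial_tu(x,0)=g(x)$) is a function $u\in C(\mathbb{R}^3\times[0,T))$ satisfying the integral equation $$u(x,t)=\partial_tW(f|x,t)+W(g|x,t)+L((V_2*u^2)u)(x,t),\quad (x,t)\in\mathbb{R}^3\times[0,T).$$ Lifespan: $T(\varepsilon)$ is the supremum of all $T\in(0,\infty]$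 such that there exists a unique solution $u$ with initial data $(0,\varepsilon u_1)$ on $\mathbb{R}^3\times[0,T)$. *)

theory Defs
  imports "HOL-Analysis.Analysis"
begin

definition sphere_param :: "real \<Rightarrow> real \<Rightarrow> real^3" where
  "sphere_param \<theta> \<phi> = vector [sin \<theta> * cos \<phi>, sin \<theta> * sin \<phi>, cos \<theta>]"

(* Surface integral over the unit sphere in spherical coordinates;
   the surface element is sin \<theta> d\<theta> d\<phi>. *)
definition sphere_integral :: "(real^3 \<Rightarrow> real) \<Rightarrow> real" where
  "sphere_integral h =
     integral {0..2*pi} (\<lambda>\<phi>. integral {0..pi} (\<lambda>\<theta>. h (sphere_param \<theta> \<phi>) * sin \<theta>))"

(* Defined for every real t, so that the two-sided derivative in t at t = 0 makes sense. *)
definition wave_W :: "(real^3 \<Rightarrow> real) \<Rightarrow> real^3 \<Rightarrow> real \<Rightarrow> real" where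
  "wave_W h x t = t / (4 * pi) * sphere_integral (\<lambda>\<omega>. h (x + t *\<^sub>R \<omega>))"

definition wave_L :: "(real^3 \<Rightarrow> real \<Rightarrow> real) \<Rightarrow> real^3 \<Rightarrow> real \<Rightarrow> real" where
  "wave_L F x t = integral {0..t} (\<lambda>s. wave_W (\<lambda>y. F y s) x (t - s))"

(* The value 0 at the singularity x = 0 is immaterial: V2 is only used under an integral. *)
definition V2 :: "real^3 \<Rightarrow> real" where
  "V2 x = 1 / (norm x)\<^sup>2"

definition space_conv :: "(real^3 \<Rightarrow> real) \<Rightarrow> (real^3 \<Rightarrow> real) \<Rightarrow> real^3 \<Rightarrow> real" where
  "space_conv V h x = (LINT y|lborel. V (x - y) * h y)"

definition space_conv_exists :: "(real^3 \<Rightarrow> real) \<Rightarrow> (real^3 \<Rightarrow> real) \<Rightarrow> real^3 \<Rightarrow> bool" where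
  "space_conv_exists V h x \<longleftrightarrow> integrable lborel (\<lambda>y. V (x - y) * h y)"

definition nonlinearity :: "(real^3 \<Rightarrow> real \<Rightarrow> real) \<Rightarrow> real^3 \<Rightarrow> real \<Rightarrow> real" where
  "nonlinearity u x t = space_conv V2 (\<lambda>y. (u y t)\<^sup>2) x * u x t"

definition time_slab :: "ennreal \<Rightarrow> ((real^3) \<times> real) set" where
  "time_slab T = UNIV \<times> {t. 0 \<le> t \<and> ennreal t < T}"

definition C1_fun :: "(real^3 \<Rightarrow> real) \<Rightarrow> bool" where
  "C1_fun f \<longleftrightarrow> (\<exists>f'. (\<forall>x. (f has_derivative blinfun_apply (f' x)) (at x)) \<and> continuous_on UNIV f')"

(* Convergence of the convolution integrals and continuity of the nonlinearity are part of the
   notion of solution because wave_L is only meaningful for continuous arguments. *)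
definition is_solution ::
  "(real^3 \<Rightarrow> real) \<Rightarrow> (real^3 \<Rightarrow> real) \<Rightarrow> ennreal \<Rightarrow> (real^3 \<Rightarrow> real \<Rightarrow> real) \<Rightarrow> bool" where
  "is_solution f g T u \<longleftrightarrow>
     C1_fun f \<and> continuous_on UNIV g \<and>
     continuous_on (time_slab T) (\<lambda>(x, t). u x t) \<and>
     (\<forall>(x, t) \<in> time_slab T. space_conv_exists V2 (\<lambda>y. (u y t)\<^sup>2) x) \<and>
     continuous_on (time_slab T) (\<lambda>(x, t). nonlinearity u x t) \<and>
     (\<forall>(x, t) \<in> time_slab T.
        u x t = deriv (\<lambda>\<tau>. wave_W f x \<tau>) t + wave_W g x t + wave_L (nonlinearity u) x t)"

(* Values of u outside the slab are irrelevant, so uniqueness means agreement on the slab. *)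
definition has_unique_solution ::
  "(real^3 \<Rightarrow> real) \<Rightarrow> (real^3 \<Rightarrow> real) \<Rightarrow> ennreal \<Rightarrow> bool" where
  "has_unique_solution f g T \<longleftrightarrow>
     (\<exists>u. is_solution f g T u \<and>
        (\<forall>v. is_solution f g T v \<longrightarrow> (\<forall>(x, t) \<in> time_slab T. v x t = u x t)))"

(* If there is no such T, the supremum in ennreal is 0. *)
definition lifespan :: "(real^3 \<Rightarrow> real) \<Rightarrow> (real^3 \<Rightarrow> real) \<Rightarrow> ennreal" where
  "lifespan f g = Sup {T. 0 < T \<and> has_unique_solution f g T}"

end

theory Submission
  imports Defs
begin

text \<open>
  The power \<open>5/2\<close> of the data is critical, and the lifespan bound comes from a logarithm that
  appears next to the light cone. Write \<open>r = |x|\<close> and \<open>\<rho> = r - t\<close>. In the exterior region \<open>\<rho> \<ge> 1\<close>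
  the domain of dependence of the local factor \<open>u\<close> stays in the region itself, while the factor
  \<open>V\<^sub>2 * u\<^sup>2\<close> is nonnegative whatever \<open>u\<close> does elsewhere. So \<open>u\<close> is positive there
  (\<open>is_solution_pos_exterior\<close>) and lower bounds may be iterated without leaving the region.

  The free wave satisfies \<open>r u \<ge> c \<epsilon> \<rho>\<^bsup>-1/2\<^esup>\<close> for \<open>t \<ge> 2 \<rho>\<close> (\<open>wave_W_data_ge\<close>). Its square,
  integrated over the shell \<open>1 \<le> \<rho> \<le> L\<close>, gives \<open>\<epsilon>\<^sup>2 ln L\<close>: this is a potential of size
  \<open>\<epsilon>\<^sup>2 ln L / t\<^sup>2\<close> for \<open>|x| \<le> 2 t\<close> (\<open>space_conv_ge_log_power\<close>). Inserted into the
  integral equation at times \<open>t\<close> comparable to \<open>\<rho>\<close>, it reproduces the bound on \<open>r u\<close> with an extra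
  factor \<open>\<epsilon>\<^sup>2 ln \<rho>\<close>. In general a bound \<open>r u \<ge> a \<rho>\<^bsup>-1/2\<^esup> (ln \<rho>)\<^bsup>p\<^esup>\<close> improves to one with
  \<open>a\<^sup>3\<close> and \<open>3 p + 1\<close> (\<open>exterior_bound_step\<close>). Each step needs a little more
  time for the same \<open>\<rho>\<close>: the bound moves from \<open>t \<ge> \<sigma> \<rho>\<close> to \<open>t \<ge> \<sigma>' \<rho>\<close>. With
  \<open>\<sigma>\<^sub>n = 3 - 2\<^bsup>-n\<^esup>\<close> the losses are only exponential in \<open>n\<close>, whereas the exponents
  \<open>p\<^sub>n = (3\<^bsup>n\<^esup> - 1) / 2\<close> grow like \<open>3\<^bsup>n\<^esup>\<close>. The result is
  \<open>r \<rho>\<^bsup>1/2\<^esup> u \<ge> 384 4\<^bsup>n\<^esup> \<xi> (\<xi>\<^sup>2 ln \<rho>)^p\<^sub>n\<close> for \<open>t \<ge> 3 \<rho>\<close>, where \<open>\<xi>\<close> is a constant multiple of \<open>\<epsilon>\<close> (\<open>exterior_bound\<close>). At \<open>\<rho> = exp (\<xi>\<^bsup>-2\<^esup>)\<close>, \<open>t = 3 \<rho>\<close> the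
  right-hand side is unbounded in \<open>n\<close>, so no solution reaches beyond that time.

  The bounds on the integral operators reduce to one geometric fact: on a sphere of radius \<open>t\<close> around \<open>x\<close>,
  the distance \<open>\<lambda>\<close> to the origin has a density proportional to \<open>\<lambda> d\<lambda>\<close>. Up to a constant this is
  \<open>wave_W_ge_shell\<close>, which follows from the rotation invariance of the surface integral on
  functions of one direction (\<open>sphere_integral_zonal\<close>).
\<close>

section \<open>Spherical means of zonal functions\<close>

lemma inner_sphere_param:
  "sphere_param a b \<bullet> sphere_param \<theta> \<phi> = cos a * cos \<theta> + sin a * sin \<theta> * cos (\<phi> - b)"
  unfolding sphere_param_def
  by (simp add: inner_vec_def sum_3 cos_diff algebra_simps)

lemma norm_sphere_param [simp]: "norm (sphere_param \<theta> \<phi>) = 1"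
  using inner_sphere_param[of \<theta> \<phi> \<theta> \<phi>]
  by (simp add: norm_eq_sqrt_inner power2_eq_square[symmetric])

lemma sphere_param_surj:
  assumes "norm e = 1"
  obtains a b where "e = sphere_param a b"
proof -
  have n: "(e$1)\<^sup>2 + (e$2)\<^sup>2 + (e$3)\<^sup>2 = 1"
    using assms by (simp add: norm_eq_sqrt_inner inner_vec_def sum_3 power2_eq_square)
  have l: "\<bar>e$3\<bar> \<le> 1"
    using n by (metis abs_square_le_1 add.commute le_add_same_cancel1 sum_power2_ge_zero)
  define a where "a = arccos (e$3)"
  have c: "cos a = e$3" using l by (simp add: a_def)
  have s: "(sin a)\<^sup>2 = (e$1)\<^sup>2 + (e$2)\<^sup>2"
    using n c sin_cos_squared_add[of a] by simp
  obtain b where "e$1 = sin a * cos b" "e$2 = sin a * sin b"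
  proof (cases "sin a = 0")
    case True
    then show ?thesis using s that[of 0] by (simp add: sum_power2_eq_zero_iff)
  next
    case False
    then have "(e$1 / sin a)\<^sup>2 + (e$2 / sin a)\<^sup>2 = 1"
      unfolding power_divide add_divide_distrib[symmetric] s[symmetric] by simp
    then obtain b where "e$1 / sin a = cos b" "e$2 / sin a = sin b"
      using sincos_total_2pi by metis
    then show ?thesis using that[of b] False by (simp add: field_simps)
  qed
  then have "e = sphere_param a b"
    using c by (simp add: sphere_param_def vec_eq_iff forall_3)
  then show thesis using that by blast
qed

lemma continuous_on_sphere_param [continuous_intros]:
  fixes f g :: "'a::t2_space \<Rightarrow> real"
  assumes "continuous_on S f" "continuous_on S g"
  shows "continuous_on S (\<lambda>z. sphere_param (f z) (g z))"
proof -
  have *: "continuous_on S (\<lambda>z. sin (f z))" "continuous_on S (\<lambda>z. cos (f z))"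
    "continuous_on S (\<lambda>z. sin (g z))" "continuous_on S (\<lambda>z. cos (g z))"
    by (rule continuous_on_sin continuous_on_cos, rule assms)+
  have "continuous_on S (\<lambda>z. sphere_param (f z) (g z) \<bullet> axis i 1)" for i :: 3
  proof -
    consider "i = 1" | "i = 2" | "i = 3" using exhaust_3[of i] by blast
    then show ?thesis
      by cases (simp_all add: inner_axis sphere_param_def continuous_on_mult *)
  qed
  then show ?thesis
    by (subst continuous_on_componentwise) (auto simp: Basis_vec_def)
qed

lemma sphere_integral_eq_integral_cbox:
  assumes "continuous_on (sphere 0 1) h"
  shows "sphere_integral h =
    integral (cbox (0, 0) (2 * pi, pi)) (\<lambda>z. h (sphere_param (snd z) (fst z)) * sin (snd z))"
proof -
  have "continuous_on (cbox (0, 0) (2 * pi, pi))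
      (\<lambda>z. h (sphere_param (snd z) (fst z)) * sin (snd z))"
    by (intro continuous_intros continuous_on_compose2[OF assms]) auto
  from integral_prod_continuous[OF this] show ?thesis
    by (simp add: sphere_integral_def)
qed

lemma sphere_integrand_integrable:
  assumes "continuous_on (sphere 0 1) h"
  shows "(\<lambda>z. h (sphere_param (snd z) (fst z)) * sin (snd z))
    integrable_on cbox (0, 0) (2 * pi, pi)"
  by (intro integrable_continuous continuous_intros continuous_on_compose2[OF assms]) auto

lemma sphere_integral_mono:
  assumes "continuous_on (sphere 0 1) g" "continuous_on (sphere 0 1) h"
    and "\<And>\<omega>. norm \<omega> = 1 \<Longrightarrow> g \<omega> \<le> h \<omega>"
  shows "sphere_integral g \<le> sphere_integral h"
  unfolding assms(1,2)[THEN sphere_integral_eq_integral_cbox]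
  using assms
  by (intro integral_le sphere_integrand_integrable)
    (auto intro!: mult_right_mono sin_ge_zero simp: mem_box Basis_prod_def)

lemma sphere_integral_diff:
  assumes "continuous_on (sphere 0 1) g" "continuous_on (sphere 0 1) h"
  shows "sphere_integral (\<lambda>\<omega>. g \<omega> - h \<omega>) = sphere_integral g - sphere_integral h"
proof -
  have diff: "continuous_on (sphere 0 1) (\<lambda>\<omega>. g \<omega> - h \<omega>)"
    by (intro continuous_intros assms)
  show ?thesis
    unfolding sphere_integral_eq_integral_cbox[OF diff]
      assms(1,2)[THEN sphere_integral_eq_integral_cbox]
    by (subst integral_diff[symmetric])
      (auto intro!: sphere_integrand_integrable assms simp: left_diff_distrib)
qed

lemma sphere_integral_const: "sphere_integral (\<lambda>\<omega>. c) = 4 * pi * c"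
proof -
  have "(sin has_integral (- cos pi - - cos 0)) {0..pi}"
    by (intro fundamental_theorem_of_calculus)
      (auto intro!: derivative_eq_intros simp: has_real_derivative_iff_has_vector_derivative[symmetric])
  then have "integral {0..pi} (\<lambda>\<theta>. c * sin \<theta>) = 2 * c"
    by (auto dest: integral_unique)
  then show ?thesis by (simp add: sphere_integral_def)
qed

text \<open>
  Rotating \<open>e\<close> along a meridian, \<open>e = e(\<alpha>)\<close>, does not change the integral: the derivative in
  \<open>\<alpha>\<close> of the integrand, including the factor \<open>sin \<theta>\<close>, is the divergence of a field in the
  \<open>(\<phi>, \<theta>)\<close>-rectangle whose flux cancels, since it is periodic in \<open>\<phi>\<close> and vanishes at
  \<open>\<theta> = 0\<close> and \<open>\<theta> = \<pi>\<close>. At \<open>\<alpha> = 0\<close> the integrand depends on \<open>cos \<theta>\<close> alone.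
\<close>
lemma sphere_integral_zonal_C1:
  fixes F F' :: "real \<Rightarrow> real"
  assumes F: "\<And>s. (F has_real_derivative F' s) (at s)" and F': "continuous_on UNIV F'"
    and e: "norm e = 1"
  shows "sphere_integral (\<lambda>\<omega>. F (e \<bullet> \<omega>)) = 2 * pi * integral {-1..1} F"
proof -
  obtain a b where ab: "e = sphere_param a b" using sphere_param_surj[OF e] .
  have contF: "continuous_on S F" for S
    using F by (meson DERIV_isCont continuous_at_imp_continuous_on)
  have contF': "continuous_on S F'" for S
    using F' continuous_on_subset by blast
  note cont = continuous_intros continuous_on_compose2[OF contF[of UNIV]]
    continuous_on_compose2[OF contF'[of UNIV]]
  define c where "c \<alpha> z = cos \<alpha> * cos (snd z) + sin \<alpha> * sin (snd z) * cos (fst z - b)"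
    for \<alpha> :: real and z :: "real \<times> real"
  let ?R = "cbox (0, 0) (2 * pi, pi)"
  define g where "g \<alpha> = integral ?R (\<lambda>z. F (c \<alpha> z) * sin (snd z))" for \<alpha>
  define c' where "c' \<alpha> z = cos \<alpha> * sin (snd z) * cos (fst z - b) - sin \<alpha> * cos (snd z)"
    for \<alpha> :: real and z :: "real \<times> real"
  have g: "sphere_integral (\<lambda>\<omega>. F (sphere_param \<alpha> b \<bullet> \<omega>)) = g \<alpha>" for \<alpha>
    unfolding g_def c_def
    by (subst sphere_integral_eq_integral_cbox) (auto intro!: cont simp: inner_sphere_param)
  \<comment> \<open>The derivative of the integrand is \<open>P - Q\<close>, where \<open>P = \<partial>\<^sub>\<phi> (cos \<theta> sin (\<phi> - b) F(c))\<close> and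
    \<open>Q = \<partial>\<^sub>\<theta> (sin \<theta> cos (\<phi> - b) F(c))\<close>.\<close>
  define P where "P \<alpha> z = cos (snd z) * cos (fst z - b) * F (c \<alpha> z)
      - cos (snd z) * sin (fst z - b) * F' (c \<alpha> z) * (sin \<alpha> * sin (snd z) * sin (fst z - b))"
    for \<alpha> z
  define Q where "Q \<alpha> z = cos (snd z) * cos (fst z - b) * F (c \<alpha> z)
      + sin (snd z) * cos (fst z - b) * F' (c \<alpha> z) *
        (sin \<alpha> * cos (snd z) * cos (fst z - b) - cos \<alpha> * sin (snd z))" for \<alpha> z
  have PQ: "F' (c \<alpha> z) * c' \<alpha> z * sin (snd z) = P \<alpha> z - Q \<alpha> z" for \<alpha> z
  proof -
    have 1: "sin (fst z - b) * sin (fst z - b) = 1 - cos (fst z - b) * cos (fst z - b)"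
      using sin_squared_eq[of "fst z - b"] by (simp add: power2_eq_square)
    show ?thesis unfolding P_def Q_def c'_def using 1 by algebra
  qed
  have contP: "continuous_on S (P \<alpha>)" and contQ: "continuous_on S (Q \<alpha>)" for \<alpha> S
    unfolding P_def Q_def c_def by (auto intro!: cont)
  have intP: "integral ?R (P \<alpha>) = 0" for \<alpha>
  proof -
    have "((\<lambda>\<phi>. P \<alpha> (\<phi>, \<theta>)) has_integral
        cos \<theta> * sin (2 * pi - b) * F (c \<alpha> (2 * pi, \<theta>)) - cos \<theta> * sin (0 - b) * F (c \<alpha> (0, \<theta>)))
        {0..2 * pi}" for \<theta>
      unfolding P_def c_def
      by (intro fundamental_theorem_of_calculus)
        (auto intro!: derivative_eq_intros DERIV_chain2[OF F]
          simp: has_real_derivative_iff_has_vector_derivative[symmetric] algebra_simps)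
    moreover have "sin (2 * pi - b) = sin (0 - b)" "cos (2 * pi - b) = cos (0 - b)"
      by (simp_all add: sin_diff cos_diff)
    ultimately have "((\<lambda>\<phi>. P \<alpha> (\<phi>, \<theta>)) has_integral 0) {0..2 * pi}" for \<theta>
      by (simp add: c_def)
    then have "integral {0..2 * pi} (\<lambda>\<phi>. P \<alpha> (\<phi>, \<theta>)) = 0" for \<theta>
      by (rule integral_unique)
    then show ?thesis
      using integral_prod_continuous[OF contP, of 0 0 "2 * pi" pi \<alpha>]
        integral_swap_continuous[of 0 0 "2 * pi" pi "\<lambda>x y. P \<alpha> (x, y)"] contP
      by simp
  qed
  have intQ: "integral ?R (Q \<alpha>) = 0" for \<alpha>
  proof -
    have "((\<lambda>\<theta>. Q \<alpha> (\<phi>, \<theta>)) has_integral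
        sin pi * cos (\<phi> - b) * F (c \<alpha> (\<phi>, pi)) - sin 0 * cos (\<phi> - b) * F (c \<alpha> (\<phi>, 0)))
        {0..pi}" for \<phi>
      unfolding Q_def c_def
      by (intro fundamental_theorem_of_calculus)
        (auto intro!: derivative_eq_intros DERIV_chain2[OF F]
          simp: has_real_derivative_iff_has_vector_derivative[symmetric] algebra_simps)
    then have "integral {0..pi} (\<lambda>\<theta>. Q \<alpha> (\<phi>, \<theta>)) = 0" for \<phi>
      by (simp add: integral_unique)
    then show ?thesis
      using integral_prod_continuous[OF contQ, of 0 0 "2 * pi" pi \<alpha>] by simp
  qed
  have "(g has_real_derivative 0) (at \<alpha>)" for \<alpha>
  proof -
    have "((\<lambda>\<alpha>. integral ?R (\<lambda>z. F (c \<alpha> z) * sin (snd z))) has_field_derivative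
        integral ?R (\<lambda>z. F' (c \<alpha> z) * c' \<alpha> z * sin (snd z))) (at \<alpha> within UNIV)"
    proof (rule leibniz_rule_field_derivative)
      show "((\<lambda>x. F (c x t) * sin (snd t)) has_real_derivative F' (c x t) * c' x t * sin (snd t))
          (at x within UNIV)" for x t
        unfolding c_def c'_def
        by (auto intro!: derivative_eq_intros DERIV_chain2[OF F] simp: algebra_simps)
      show "(\<lambda>z. F (c x z) * sin (snd z)) integrable_on cbox (0, 0) (2 * pi, pi)" for x
        unfolding c_def by (intro integrable_continuous cont) auto
      show "continuous_on (UNIV \<times> cbox (0, 0) (2 * pi, pi))
          (\<lambda>(x, t). F' (c x t) * c' x t * sin (snd t))"
        unfolding c_def c'_def case_prod_beta by (intro cont) auto
    qed auto
    also have "integral ?R (\<lambda>z. F' (c \<alpha> z) * c' \<alpha> z * sin (snd z)) = integral ?R (P \<alpha>) - integral ?R (Q \<alpha>)"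
      unfolding PQ by (intro integral_diff integrable_continuous contP contQ)
    finally show ?thesis by (simp add: g_def[abs_def] intP intQ)
  qed
  then have "g a = g 0" by (rule DERIV_isconst_all[rule_format])
  also have "g 0 = integral {0..2 * pi} (\<lambda>\<phi>. integral {0..pi} (\<lambda>\<theta>. F (cos \<theta>) * sin \<theta>))"
    unfolding g_def c_def
    by (subst integral_prod_continuous) (auto intro!: cont)
  also have "integral {0..pi} (\<lambda>\<theta>. F (cos \<theta>) * sin \<theta>) = integral {-1..1} F"
  proof -
    define G where "G x = integral {-1..x} F" for x
    have G: "(G has_real_derivative F x) (at x within {-1..1})" if "x \<in> {-1..1}" for x
      unfolding G_def
      by (rule integral_has_real_derivative[OF contF that])
    have "((\<lambda>\<theta>. F (cos \<theta>) * sin \<theta>) has_integral (- G (cos pi) - - G (cos 0))) {0..pi}"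
    proof (intro fundamental_theorem_of_calculus)
      fix x
      have "cos ` {0..pi} \<subseteq> {-1..1}" by auto
      have "((\<lambda>\<theta>. G (cos \<theta>)) has_real_derivative F (cos x) * (- sin x)) (at x within {0..pi})"
        using \<open>cos ` {0..pi} \<subseteq> {-1..1}\<close> DERIV_image_chain[of G "F (cos x)" cos x "{0..pi}" "- sin x", unfolded o_def]
          DERIV_subset[OF G[of "cos x"], of "cos ` {0..pi}"]
          has_field_derivative_at_within[OF DERIV_cos, of x "{0..pi}"]
        by auto
      then show "((\<lambda>\<theta>. - G (cos \<theta>)) has_vector_derivative F (cos x) * sin x) (at x within {0..pi})"
        unfolding has_real_derivative_iff_has_vector_derivative[symmetric]
        by (auto dest: DERIV_minus)
    qed auto
    then show ?thesis by (simp add: integral_unique G_def)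
  qed
  finally show ?thesis using g[of a] by (simp add: ab)
qed

text \<open>
  The Funk--Hecke formula in degree zero (Archimedes' hat-box theorem). Both sides are
  continuous for uniform convergence on \<open>{-1..1}\<close>, so polynomials suffice.
\<close>
lemma sphere_integral_zonal:
  fixes F :: "real \<Rightarrow> real"
  assumes F: "continuous_on {-1..1} F" and e: "norm e = 1"
  shows "sphere_integral (\<lambda>\<omega>. F (e \<bullet> \<omega>)) = 2 * pi * integral {-1..1} F"
proof -
  let ?d = "sphere_integral (\<lambda>\<omega>. F (e \<bullet> \<omega>)) - 2 * pi * integral {-1..1} F"
  have inner: "e \<bullet> \<omega> \<in> {-1..1}" if "norm \<omega> = 1" for \<omega>
    using Cauchy_Schwarz_ineq2[of e \<omega>] e that by auto
  have contF: "continuous_on (sphere 0 1) (\<lambda>\<omega>. F (e \<bullet> \<omega>))"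
    by (intro continuous_on_compose2[OF F] continuous_intros) (use inner in auto)
  have "\<bar>?d\<bar> \<le> \<eta>" if "\<eta> > 0" for \<eta>
  proof -
    define \<delta> where "\<delta> = \<eta> / (8 * pi)"
    have "\<delta> > 0" using that by (simp add: \<delta>_def)
    then obtain P where P: "real_polynomial_function P" "\<And>s. s \<in> {-1..1} \<Longrightarrow> \<bar>F s - P s\<bar> < \<delta>"
      using Stone_Weierstrass_real_polynomial_function[OF compact_Icc F] by blast
    obtain P' where P': "real_polynomial_function P'" "\<And>s. (P has_real_derivative P' s) (at s)"
      using has_real_derivative_polynomial_function[OF P(1)] by blast
    have contP: "continuous_on S P" "continuous_on S P'" for S
      using P(1) P'(1)
      by (simp_all add: continuous_on_polymonial_function real_polynomial_function_eq)
    have contP2: "continuous_on (sphere 0 1) (\<lambda>\<omega>. P (e \<bullet> \<omega>))"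
      by (intro continuous_on_compose2[OF contP(1)[of UNIV]] continuous_intros) auto
    have 0: "sphere_integral (\<lambda>\<omega>. P (e \<bullet> \<omega>)) = 2 * pi * integral {-1..1} P"
      by (rule sphere_integral_zonal_C1[OF P'(2) contP(2) e])
    have "sphere_integral (\<lambda>\<omega>. F (e \<bullet> \<omega>) - P (e \<bullet> \<omega>)) \<le> sphere_integral (\<lambda>_. \<delta>)"
      using P(2)[OF inner]
      by (intro sphere_integral_mono continuous_intros contF contP2) (force simp: abs_less_iff)
    moreover have "sphere_integral (\<lambda>_. - \<delta>) \<le> sphere_integral (\<lambda>\<omega>. F (e \<bullet> \<omega>) - P (e \<bullet> \<omega>))"
      using P(2)[OF inner]
      by (intro sphere_integral_mono continuous_intros contF contP2) (force simp: abs_less_iff)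
    ultimately have 1: "\<bar>sphere_integral (\<lambda>\<omega>. F (e \<bullet> \<omega>)) - sphere_integral (\<lambda>\<omega>. P (e \<bullet> \<omega>))\<bar> \<le> 4 * pi * \<delta>"
      by (simp add: sphere_integral_diff[OF contF contP2] sphere_integral_const abs_le_iff)
    have "norm (integral {-1..1} (\<lambda>s. F s - P s)) \<le> \<delta> * (1 - (-1))"
      using P(2) by (intro integral_bound continuous_intros F contP) (auto intro: less_imp_le)
    then have 2: "\<bar>integral {-1..1} F - integral {-1..1} P\<bar> \<le> 2 * \<delta>"
      by (subst (asm) integral_diff) (auto intro!: integrable_continuous_real F contP)
    have "?d = (sphere_integral (\<lambda>\<omega>. F (e \<bullet> \<omega>)) - sphere_integral (\<lambda>\<omega>. P (e \<bullet> \<omega>)))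
        - 2 * pi * (integral {-1..1} F - integral {-1..1} P)"
      by (simp add: 0 algebra_simps)
    also have "\<bar>\<dots>\<bar> \<le> 4 * pi * \<delta> + 2 * pi * (2 * \<delta>)"
      using 1 mult_left_mono[OF 2, of "2 * pi"]
      by (intro order_trans[OF abs_triangle_ineq4 add_mono]) (simp_all add: abs_mult)
    also have "\<dots> = \<eta>" by (simp add: \<delta>_def)
    finally show ?thesis .
  qed
  then have "\<bar>?d\<bar> \<le> 0" by (rule field_le_epsilon[of _ 0, simplified])
  then show ?thesis by simp
qed

lemma sphere_integral_nonneg:
  assumes "\<And>\<omega>. norm \<omega> = 1 \<Longrightarrow> 0 \<le> h \<omega>"
  shows "0 \<le> sphere_integral h"
proof -
  have nn: "0 \<le> integral S f" if "\<And>x. x \<in> S \<Longrightarrow> 0 \<le> f x" for S and f :: "real \<Rightarrow> real"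
    using that integral_nonneg[of f S] not_integrable_integral[of f S] by fastforce
  show ?thesis
    unfolding sphere_integral_def
    by (intro nn mult_nonneg_nonneg sin_ge_zero assms) auto
qed

lemma wave_W_nonneg:
  assumes "0 \<le> t" "\<And>y. dist x y = t \<Longrightarrow> 0 \<le> h y"
  shows "0 \<le> wave_W h x t"
  unfolding wave_W_def using assms
  by (intro mult_nonneg_nonneg sphere_integral_nonneg) (auto simp: dist_norm)

lemma wave_W_ge:
  assumes h: "continuous_on (sphere x t) h" and t: "0 \<le> t"
    and ge: "\<And>y. dist x y = t \<Longrightarrow> c \<le> h y"
  shows "c * t \<le> wave_W h x t"
proof -
  have "sphere_integral (\<lambda>\<omega>. c) \<le> sphere_integral (\<lambda>\<omega>. h (x + t *\<^sub>R \<omega>))"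
    using t by (intro sphere_integral_mono continuous_on_compose2[OF h] continuous_intros ge)
      (auto simp: dist_norm)
  then have "t / (4 * pi) * (4 * pi * c) \<le> wave_W h x t"
    unfolding wave_W_def sphere_integral_const using t by (intro mult_left_mono) auto
  then show ?thesis by (simp add: mult.commute)
qed

text \<open>
  For radial \<open>h\<close> the value \<open>W(h|x,t)\<close> is the integral of \<open>h\<close> against \<open>\<lambda> d\<lambda> / (2 |x|)\<close> in the
  variable \<open>\<lambda> = |y|\<close>, so the indicator function of the shell would give the constant \<open>1/4\<close>. A continuous minorant of the indicator function
  of the shell loses a factor: in the zonal variable a parabola with maximum \<open>m\<close> replaces the constant \<open>m\<close>
  and has \<open>2/3\<close> of its integral.
\<close>
lemma wave_W_ge_shell:
  assumes t: "0 < t" "t < norm x" and h: "continuous_on (sphere x t) h"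
    and nonneg: "\<And>y. dist x y = t \<Longrightarrow> 0 \<le> h y"
    and l: "norm x - t \<le> l1" "l1 < l2" "l2 \<le> norm x + t"
    and m: "0 \<le> m" "\<And>y. dist x y = t \<Longrightarrow> l1 \<le> norm y \<Longrightarrow> norm y \<le> l2 \<Longrightarrow> m \<le> h y"
  shows "m * (l2\<^sup>2 - l1\<^sup>2) / 6 \<le> norm x * wave_W h x t"
proof -
  define r where "r = norm x"
  have r: "r > 0" unfolding r_def using t by linarith
  define e where "e = x /\<^sub>R r"
  have "x \<noteq> 0" using r by (auto simp: r_def)
  then have e: "norm e = 1" "x = r *\<^sub>R e" by (auto simp: e_def r_def)
  have norm2: "(norm (x + t *\<^sub>R \<omega>))\<^sup>2 = r\<^sup>2 + t\<^sup>2 + 2 * r * t * (e \<bullet> \<omega>)" if "norm \<omega> = 1" for \<omega>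
    using that e(1) unfolding e(2) power2_norm_eq_inner norm_eq_1
    by (simp add: inner_add inner_commute power2_eq_square algebra_simps)
  \<comment> \<open>\<open>|x + t \<omega>| = l\<close> exactly if \<open>e \<bullet> \<omega> = c l\<close>\<close>
  define c where "c l = (l\<^sup>2 - r\<^sup>2 - t\<^sup>2) / (2 * r * t)" for l
  have l0: "0 < l1" using l t by simp
  have c_mono: "c l1 < c l2"
    unfolding c_def using r t l l0 by (intro divide_strict_right_mono) (auto intro: power_strict_mono)
  have c1: "-1 \<le> c l1"
  proof -
    have "(r - t)\<^sup>2 \<le> l1\<^sup>2" using l t unfolding r_def by (intro power_mono) auto
    then show ?thesis using r t by (simp add: c_def field_simps power2_eq_square)
  qed
  have c2: "c l2 \<le> 1"
  proof -
    have "l2\<^sup>2 \<le> (r + t)\<^sup>2" using l l0 unfolding r_def by (intro power_mono) auto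
    then show ?thesis using r t by (simp add: c_def field_simps power2_eq_square)
  qed
  define q where "q s = (s - c l1) * (c l2 - s)" for s
  define d where "d = c l2 - c l1"
  define F where "F s = max 0 (4 * m / d\<^sup>2 * q s)" for s
  have d: "d > 0" using c_mono by (simp add: d_def)
  have contF: "continuous_on S F" for S unfolding F_def q_def by (intro continuous_intros)
  have Fh: "F (e \<bullet> \<omega>) \<le> h (x + t *\<^sub>R \<omega>)" if \<omega>: "norm \<omega> = 1" for \<omega>
  proof (cases "c l1 \<le> e \<bullet> \<omega> \<and> e \<bullet> \<omega> \<le> c l2")
    case True
    then have "l1\<^sup>2 \<le> (norm (x + t *\<^sub>R \<omega>))\<^sup>2" "(norm (x + t *\<^sub>R \<omega>))\<^sup>2 \<le> l2\<^sup>2"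
      unfolding norm2[OF \<omega>] using r t by (simp_all add: c_def field_simps)
    then have "l1 \<le> norm (x + t *\<^sub>R \<omega>)" "norm (x + t *\<^sub>R \<omega>) \<le> l2"
      using l0 l by (auto dest: power2_le_imp_le)
    then have "m \<le> h (x + t *\<^sub>R \<omega>)"
      using \<omega> t by (intro m) (auto simp: dist_norm)
    moreover have "4 * q s \<le> d\<^sup>2" for s
      using zero_le_square[of "2 * s - c l1 - c l2"]
      by (simp add: q_def d_def power2_eq_square algebra_simps)
    then have "4 * m / d\<^sup>2 * q s \<le> m" for s
      using d m(1) mult_left_mono[of "4 * q s" "d\<^sup>2" m] by (simp add: field_simps)
    ultimately show ?thesis unfolding F_def using m(1) by (simp add: max_def) (meson order_trans)
  next
    case False
    then have "q (e \<bullet> \<omega>) \<le> 0"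
      unfolding q_def using c_mono by (auto simp: mult_le_0_iff)
    then have "4 * m / d\<^sup>2 * q (e \<bullet> \<omega>) \<le> 0" using m(1) by (intro mult_nonneg_nonpos) auto
    then have "F (e \<bullet> \<omega>) = 0" unfolding F_def by simp
    then show ?thesis using \<omega> t by (auto intro!: nonneg simp: dist_norm)
  qed
  have int: "integral {-1..1} F \<ge> 2 / 3 * m * d"
  proof -
    define Q where "Q s = d * (s - c l1)^2 / 2 - (s - c l1)^3 / 3" for s
    have "((\<lambda>s. 4 * m / d\<^sup>2 * q s) has_integral 4 * m / d\<^sup>2 * (Q (c l2) - Q (c l1))) {c l1..c l2}"
      using c_mono unfolding Q_def q_def d_def
      by (intro has_integral_mult_right fundamental_theorem_of_calculus)
        (auto intro!: derivative_eq_intros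
          simp: has_real_derivative_iff_has_vector_derivative[symmetric] power2_eq_square field_simps)
    also have "4 * m / d\<^sup>2 * (Q (c l2) - Q (c l1)) = 2 / 3 * m * d"
      unfolding Q_def d_def[symmetric] using d by (simp add: field_simps power2_eq_square power3_eq_cube)
    finally have "2 / 3 * m * d = integral {c l1..c l2} (\<lambda>s. 4 * m / d\<^sup>2 * q s)"
      by (rule integral_unique[symmetric])
    also have "\<dots> \<le> integral {c l1..c l2} F"
      using contF by (intro integral_le integrable_continuous_real continuous_intros)
        (auto simp: F_def q_def intro!: continuous_intros)
    also have "\<dots> \<le> integral {-1..1} F"
      using contF c1 c2 by (intro integral_subset_le integrable_continuous_real) (auto simp: F_def)
    finally show ?thesis .
  qed
  have "2 * pi * (2 / 3 * m * d) \<le> sphere_integral (\<lambda>\<omega>. F (e \<bullet> \<omega>))"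
    unfolding sphere_integral_zonal[OF contF e(1)] using int by (intro mult_left_mono) auto
  also have "\<dots> \<le> sphere_integral (\<lambda>\<omega>. h (x + t *\<^sub>R \<omega>))"
    using t by (intro sphere_integral_mono Fh continuous_on_compose2[OF h]
        continuous_on_compose2[OF contF[of UNIV]] continuous_intros) (auto simp: dist_norm)
  finally have "t / (4 * pi) * (2 * pi * (2 / 3 * m * d)) \<le> wave_W h x t"
    unfolding wave_W_def using t by (intro mult_left_mono) auto
  then have "r * (t / (4 * pi) * (2 * pi * (2 / 3 * m * d))) \<le> r * wave_W h x t"
    using r by (intro mult_left_mono) auto
  also have "r * (t / (4 * pi) * (2 * pi * (2 / 3 * m * d))) = m * (2 * r * t * d) / 6"
    by simp
  also have "2 * r * t * d = l2\<^sup>2 - l1\<^sup>2"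
    using r t unfolding d_def c_def diff_divide_distrib[symmetric] by simp
  finally show ?thesis by (simp add: r_def)
qed

section \<open>The retarded operators and positivity outside the light cone\<close>

lemma continuous_on_wave_W_backward:
  assumes F: "continuous_on (UNIV \<times> {0..t}) (\<lambda>(y, s). F y s)"
  shows "continuous_on {0..t} (\<lambda>s. wave_W (\<lambda>y. F y s) x (t - s))"
proof -
  have Fs: "continuous_on S (\<lambda>y. F y s)" if "s \<in> {0..t}" for s S
    using that by (intro continuous_on_compose2[OF F, of _ "\<lambda>y. (y, s)", simplified] continuous_intros) auto
  let ?f = "\<lambda>s z. F (x + (t - s) *\<^sub>R sphere_param (snd z) (fst z)) s * sin (snd z)"
  have "continuous_on ({0..t} \<times> cbox (0, 0) (2 * pi, pi)) (\<lambda>(s, z). ?f s z)"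
    unfolding case_prod_beta
    by (intro continuous_intros continuous_on_compose2[OF F,
          of _ "\<lambda>w. (x + (t - fst w) *\<^sub>R sphere_param (snd (snd w)) (fst (snd w)), fst w)", simplified])
      auto
  from integral_continuous_on_param[OF this]
  have "continuous_on {0..t} (\<lambda>s. (t - s) / (4 * pi) * integral (cbox (0, 0) (2 * pi, pi)) (?f s))"
    by (intro continuous_intros) auto
  then show ?thesis
  proof (rule continuous_on_eq)
    fix s assume s: "s \<in> {0..t}"
    have "continuous_on (sphere 0 1) (\<lambda>\<omega>. F (x + (t - s) *\<^sub>R \<omega>) s)"
      by (intro continuous_on_compose2[OF Fs[OF s, of UNIV]] continuous_intros) auto
    then show "(t - s) / (4 * pi) * integral (cbox (0, 0) (2 * pi, pi)) (?f s)
        = wave_W (\<lambda>y. F y s) x (t - s)"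
      by (simp add: wave_W_def sphere_integral_eq_integral_cbox)
  qed
qed

lemma wave_L_ge:
  assumes F: "continuous_on (UNIV \<times> {0..t}) (\<lambda>(y, s). F y s)" and t: "0 \<le> t"
    and ge: "\<And>s y. 0 \<le> s \<Longrightarrow> s < t \<Longrightarrow> dist x y = t - s \<Longrightarrow> c \<le> F y s"
  shows "c * t\<^sup>2 / 2 \<le> wave_L F x t"
proof -
  have Fs: "continuous_on S (\<lambda>y. F y s)" if "s \<in> {0..t}" for s S
    using that by (intro continuous_on_compose2[OF F, of _ "\<lambda>y. (y, s)", simplified] continuous_intros) auto
  have "((\<lambda>s. c * (t - s)) has_integral (- (c * (t - t)\<^sup>2 / 2)) - (- (c * (t - 0)\<^sup>2 / 2))) {0..t}"
    using t by (intro fundamental_theorem_of_calculus)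
      (auto intro!: derivative_eq_intros simp: has_real_derivative_iff_has_vector_derivative[symmetric]
        field_simps)
  then have "((\<lambda>s. c * (t - s)) has_integral c * t\<^sup>2 / 2) {0..t}"
    by simp
  then have "c * t\<^sup>2 / 2 = integral {0..t} (\<lambda>s. c * (t - s))"
    by (rule integral_unique[symmetric])
  also have "\<dots> \<le> wave_L F x t"
    unfolding wave_L_def
  proof (intro integral_le integrable_continuous_real continuous_on_wave_W_backward F continuous_intros)
    fix s assume s: "s \<in> {0..t}"
    show "c * (t - s) \<le> wave_W (\<lambda>y. F y s) x (t - s)"
    proof (cases "s = t")
      case True
      then show ?thesis by (simp add: wave_W_def)
    next
      case False
      then show ?thesis using s by (intro wave_W_ge Fs ge) auto
    qed
  qed
  finally show ?thesis .
qed

text \<open>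
  Lower bounds of the source are used only on a window of times; elsewhere only its sign counts.
\<close>
lemma wave_L_ge_window:
  assumes F: "continuous_on (UNIV \<times> {0..t}) (\<lambda>(y, s). F y s)"
    and nonneg: "\<And>s y. 0 \<le> s \<Longrightarrow> s < t \<Longrightarrow> dist x y = t - s \<Longrightarrow> 0 \<le> F y s"
    and s: "0 \<le> s1" "s1 \<le> s2" "s2 \<le> t"
    and c: "\<And>s. s1 \<le> s \<Longrightarrow> s \<le> s2 \<Longrightarrow> c \<le> wave_W (\<lambda>y. F y s) x (t - s)"
  shows "c * (s2 - s1) \<le> wave_L F x t"
proof -
  note cont = continuous_on_wave_W_backward[OF F, of x]
  have "c * (s2 - s1) = integral {s1..s2} (\<lambda>s. c)" using s by simp
  also have "\<dots> \<le> integral {s1..s2} (\<lambda>s. wave_W (\<lambda>y. F y s) x (t - s))"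
    using s c by (intro integral_le integrable_continuous_real continuous_on_subset[OF cont]) auto
  also have "\<dots> \<le> wave_L F x t"
    unfolding wave_L_def
  proof (intro integral_subset_le integrable_continuous_real continuous_on_subset[OF cont] ballI)
    fix s assume "s \<in> {0..t}"
    then show "0 \<le> wave_W (\<lambda>y. F y s) x (t - s)"
      by (cases "s = t") (auto simp: wave_W_def[of _ _ 0] intro!: wave_W_nonneg nonneg)
  qed (use s in auto)
  finally show ?thesis .
qed

lemma is_solution_integral_equation:
  assumes "is_solution (\<lambda>x. 0) g T u" "0 \<le> t" "ennreal t < T"
  shows "u x t = wave_W g x t + wave_L (nonlinearity u) x t"
proof -
  have "sphere_integral (\<lambda>\<omega>. 0) = 0" using sphere_integral_const[of 0] by simp
  then have "wave_W (\<lambda>x. 0) x = (\<lambda>\<tau>. 0)" by (simp add: wave_W_def fun_eq_iff)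
  moreover have "(x, t) \<in> time_slab T" using assms by (simp add: time_slab_def)
  ultimately show ?thesis
    using assms(1) by (auto simp: is_solution_def)
qed

lemma is_solution_continuous:
  assumes "is_solution f g T u" "ennreal t < T"
  shows "continuous_on (UNIV \<times> {0..t}) (\<lambda>(y, s). u y s)"
    and "continuous_on (UNIV \<times> {0..t}) (\<lambda>(y, s). nonlinearity u y s)"
proof -
  have "ennreal s < T" if "s \<le> t" for s
    using ennreal_leI[OF that] assms(2) by (rule le_less_trans)
  then have "UNIV \<times> {0..t} \<subseteq> time_slab T" by (auto simp: time_slab_def)
  then show "continuous_on (UNIV \<times> {0..t}) (\<lambda>(y, s). u y s)"
    "continuous_on (UNIV \<times> {0..t}) (\<lambda>(y, s). nonlinearity u y s)"
    using assms(1) by (auto simp: is_solution_def intro: continuous_on_subset)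
qed

lemma nonlinearity_nonneg:
  assumes "0 \<le> u x t"
  shows "0 \<le> nonlinearity u x t"
  using assms unfolding nonlinearity_def space_conv_def V2_def
  by (intro mult_nonneg_nonneg Bochner_Integration.integral_nonneg) auto

text \<open>
  A first-time argument in the backward cone \<open>D\<close> of \<open>(x0, t0)\<close>, which lies in the exterior region.
  On \<open>D\<close> the free part is at least \<open>b s\<close> with \<open>b > 0\<close>, and the Duhamel term is \<open>O(s\<^sup>2)\<close>, so \<open>u\<close> is
  positive at small positive times. At the first time where positivity fails, all earlier sources in
  the cone are nonnegative and the free part makes \<open>u\<close> positive after all.
\<close>
lemma is_solution_pos_exterior:
  assumes sol: "is_solution (\<lambda>x. 0) g T u"
    and pos: "\<And>x. 1 \<le> norm x \<Longrightarrow> 0 < g x"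
    and t0: "0 < t0" "ennreal t0 < T" and x0: "t0 + 1 \<le> norm x0"
  shows "0 < u x0 t0"
proof (rule ccontr)
  assume not_pos: "\<not> 0 < u x0 t0"
  have g: "continuous_on S g" for S
    using sol by (auto simp: is_solution_def intro: continuous_on_subset)
  have T: "ennreal s < T" if "s \<le> t0" for s
    using ennreal_leI[OF that] t0(2) by (rule le_less_trans)
  define D where "D = {p. 0 \<le> snd p \<and> dist x0 (fst p) \<le> t0 - snd p}"
  have D_le: "s \<le> t0" if "(y, s) \<in> D" for y s
    using that zero_le_dist[of x0 y] unfolding D_def by (simp del: zero_le_dist)
  have D_past: "(z, s') \<in> D" if "(y, s) \<in> D" "0 \<le> s'" "dist y z = s - s'" for y z s s'
    using that dist_triangle[of x0 z y] by (auto simp: D_def)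
  have "D \<subseteq> cball x0 t0 \<times> {0..t0}" using D_le by (auto simp: D_def)
  moreover have "closed D"
    unfolding D_def by (intro closed_Collect_conj closed_Collect_le continuous_intros)
  ultimately have D: "compact D"
    using bounded_subset[OF bounded_Times[OF bounded_cball bounded_closed_interval]]
    by (simp add: compact_eq_bounded_closed)
  have D_slab: "D \<subseteq> UNIV \<times> {0..t0}" using D_le by (auto simp: D_def)
  have contu: "continuous_on D (\<lambda>(y, s). u y s)"
    and contN: "continuous_on D (\<lambda>(y, s). nonlinearity u y s)"
    using is_solution_continuous[OF sol t0(2)] D_slab by (auto intro: continuous_on_subset)
  obtain M where M: "M > 0" "\<And>y s. (y, s) \<in> D \<Longrightarrow> \<bar>nonlinearity u y s\<bar> \<le> M"
    using compact_imp_bounded[OF compact_continuous_image[OF contN D]]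
    unfolding bounded_pos by (force simp: image_iff)
  obtain b where b: "b > 0" "\<And>y. 1 \<le> norm y \<Longrightarrow> norm y \<le> norm x0 + t0 \<Longrightarrow> b \<le> g y"
  proof -
    let ?S = "{y :: real^3. 1 \<le> norm y} \<inter> cball 0 (norm x0 + t0)"
    have "compact ?S"
      by (intro closed_Int_compact closed_Collect_le continuous_intros compact_cball)
    moreover have "x0 \<in> ?S" using x0 t0 by simp
    ultimately obtain y0 where "y0 \<in> ?S" "\<forall>y\<in>?S. g y0 \<le> g y"
      using continuous_attains_inf[of ?S g] g by blast
    then show ?thesis using that[of "g y0"] pos[of y0] by auto
  qed
  have W: "b * s \<le> wave_W g y s" if "(y, s) \<in> D" for y s
  proof (intro wave_W_ge g b)
    show "0 \<le> s" using that by (simp add: D_def)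
    fix z assume "dist y z = s"
    then have "dist x0 z \<le> t0" "dist z x0 \<le> t0"
      using that dist_triangle[of x0 z y] by (auto simp: D_def dist_commute)
    then show "1 \<le> norm z" "norm z \<le> norm x0 + t0"
      using x0 norm_triangle_ineq2[of x0 z] norm_triangle_ineq2[of z x0] by (auto simp: dist_norm)
  qed
  have u_ge: "b * s + c * s\<^sup>2 / 2 \<le> u y s"
    if "(y, s) \<in> D" "\<And>s' z. 0 \<le> s' \<Longrightarrow> s' < s \<Longrightarrow> (z, s') \<in> D \<Longrightarrow> c \<le> nonlinearity u z s'" for y s c
  proof -
    have s: "0 \<le> s" "ennreal s < T" using that D_le T by (auto simp: D_def)
    have "c * s\<^sup>2 / 2 \<le> wave_L (nonlinearity u) y s"
      using s that D_past by (intro wave_L_ge is_solution_continuous[OF sol]) auto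
    then show ?thesis
      using W[OF that(1)] is_solution_integral_equation[OF sol s, of y] by simp
  qed
  \<comment> \<open>\<open>s \<le> b / M\<close> makes the Duhamel term at most half of the free part.\<close>
  define \<delta> where "\<delta> = min (b / M) t0"
  have \<delta>: "\<delta> > 0" "\<delta> \<le> t0" "M * \<delta> \<le> b"
    using b M t0 by (auto simp: \<delta>_def min_def field_simps)
  have small: "0 < u y s" if "(y, s) \<in> D" "0 < s" "s \<le> \<delta>" for y s
  proof -
    have "b * s + (- M) * s\<^sup>2 / 2 \<le> u y s"
      using M(2) by (intro u_ge that) (force simp: abs_le_iff)
    moreover have "M * s\<^sup>2 \<le> b * s"
      using that order_trans[OF mult_left_mono[OF that(3), of M] \<delta>(3)] M(1)
      by (auto simp: power2_eq_square mult.assoc[symmetric] intro!: mult_right_mono)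
    moreover have "0 < b * s" using b that by simp
    ultimately show ?thesis by simp
  qed
  define D' where "D' = D \<inter> {p. \<delta> \<le> snd p}"
  define Z where "Z = D' \<inter> (\<lambda>(y, s). u y s) -` {..0}"
  have D': "compact D'"
    unfolding D'_def by (intro compact_Int_closed D closed_Collect_le continuous_intros)
  have "closed Z"
    unfolding Z_def using compact_imp_closed[OF D']
    by (intro continuous_closed_preimage continuous_on_subset[OF contu]) (auto simp: D'_def)
  then have "compact Z"
    using D' unfolding Z_def by (metis Int_absorb1 Int_lower1 closed_Int_compact inf_commute)
  moreover have "(x0, t0) \<in> Z" using not_pos \<delta> t0 by (auto simp: Z_def D'_def D_def)
  moreover have "continuous_on Z snd" by (intro continuous_intros)
  ultimately obtain p where p: "p \<in> Z" "\<And>q. q \<in> Z \<Longrightarrow> snd p \<le> snd q"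
    using continuous_attains_inf[of Z snd] by blast
  obtain y s where ys: "p = (y, s)" by force
  have "(y, s) \<in> D" "\<delta> \<le> s" "u y s \<le> 0" using p ys by (auto simp: Z_def D'_def)
  have "b * s + 0 * s\<^sup>2 / 2 \<le> u y s"
  proof (intro u_ge \<open>(y, s) \<in> D\<close> nonlinearity_nonneg)
    fix s' z assume z: "0 \<le> s'" "s' < s" "(z, s') \<in> D"
    consider "s' = 0" | "0 < s'" "s' \<le> \<delta>" | "\<delta> < s'" using z by linarith
    then show "0 \<le> u z s'"
    proof cases
      case 1
      then show ?thesis
        using is_solution_integral_equation[OF sol, of 0 z] T[of 0] t0
        by (simp add: wave_W_def wave_L_def)
    next
      case 2
      then show ?thesis using small z by (simp add: less_imp_le)
    next
      case 3
      then show ?thesis using p(2)[of "(z, s')"] z ys by (force simp: Z_def D'_def)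
    qed
  qed
  moreover have "0 < b * s" using b \<delta> \<open>\<delta> \<le> s\<close> by simp
  ultimately show False using \<open>u y s \<le> 0\<close> by simp
qed

section \<open>The nonlocal potential generated near the light cone\<close>

text \<open>
  Polar coordinates for radial functions: both measures give a half-line \<open>{..a}\<close> the volume of a ball.
\<close>
lemma distr_norm_lborel:
  "distr (lborel :: (real^3) measure) borel norm =
    density lborel (\<lambda>l. ennreal (4 * pi * l\<^sup>2) * indicator {0..} l)" (is "?M = ?N")
proof (rule measure_eqI_generator_eq)
  let ?E = "range (\<lambda>a::real. {..a})"
  show "Int_stable ?E" by (auto simp: Int_stable_def)
  show "?E \<subseteq> Pow UNIV" by simp
  have "sets borel = sigma_sets UNIV ?E"
    by (subst borel_eq_atMost) (simp add: sets_measure_of)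
  then show "sets ?M = sigma_sets UNIV ?E" "sets ?N = sigma_sets UNIV ?E" by simp_all
  have ball: "emeasure ?M {..a} = ennreal (4 / 3 * pi * (max 0 a) ^ 3)" for a
  proof -
    have "emeasure ?M {..a} = emeasure lborel (norm -` {..a} :: (real^3) set)"
      by (subst emeasure_distr) auto
    also have "(norm -` {..a} :: (real^3) set) = (if a < 0 then {} else cball 0 a)"
      by (auto simp: not_less) (meson norm_ge_zero not_less order_trans)
    finally show ?thesis
      using emeasure_cball[of a "0 :: real^3"] by (simp add: unit_ball_vol_3 max_def)
  qed
  show "emeasure ?M X = emeasure ?N X" if X: "X \<in> ?E" for X
  proof -
    obtain a where X: "X = {..a}" using X by auto
    have "emeasure ?N X = (\<integral>\<^sup>+l. ennreal (4 * pi * l\<^sup>2) * indicator {0..max 0 a} l \<partial>lborel)"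
    proof (subst emeasure_density)
      show "(\<integral>\<^sup>+l. ennreal (4 * pi * l\<^sup>2) * indicator {0..} l * indicator X l \<partial>lborel)
          = (\<integral>\<^sup>+l. ennreal (4 * pi * l\<^sup>2) * indicator {0..max 0 a} l \<partial>lborel)"
        by (intro nn_integral_cong) (auto simp: X indicator_def max_def)
    qed (auto simp: X)
    also have "\<dots> = ennreal (4 / 3 * pi * (max 0 a) ^ 3 - 4 / 3 * pi * 0 ^ 3)"
      by (rule nn_integral_FTC_Icc) (auto intro!: derivative_eq_intros)
    finally show ?thesis using ball by (simp add: X)
  qed
  show "range (\<lambda>n. {..real n}) \<subseteq> ?E" by auto
  show "(\<Union>n. {..real n}) = UNIV" by (auto intro: real_arch_simple)
  show "emeasure ?M {..real n} \<noteq> \<infinity>" for n by (simp add: ball)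
qed

lemma nn_integral_radial:
  assumes [measurable]: "g \<in> borel_measurable borel"
  shows "(\<integral>\<^sup>+z. g (norm z) \<partial>(lborel :: (real^3) measure)) =
    (\<integral>\<^sup>+l. ennreal (4 * pi * l\<^sup>2) * indicator {0..} l * g l \<partial>lborel)"
proof -
  have "(\<integral>\<^sup>+z. g (norm z) \<partial>(lborel :: (real^3) measure)) = (\<integral>\<^sup>+l. g l \<partial>distr (lborel :: (real^3) measure) borel norm)"
    by (subst nn_integral_distr) auto
  also have "\<dots> = (\<integral>\<^sup>+l. ennreal (4 * pi * l\<^sup>2) * indicator {0..} l * g l \<partial>lborel)"
    unfolding distr_norm_lborel by (subst nn_integral_density) auto
  finally show ?thesis .
qed

text \<open>
  For \<open>|y| \<le> 2 s\<close> and \<open>|z| \<le> 2 s\<close> the kernel is at least \<open>1 / (16 s\<^sup>2)\<close>. In polar coordinates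
  the factor \<open>l\<^sup>2\<close> cancels against the \<open>l\<^bsup>-2\<^esup>\<close> in the lower bound of \<open>w\<^sup>2\<close>, which leaves the
  integral of \<open>(ln \<rho>)\<^bsup>2p\<^esup> / \<rho>\<close> over \<open>1 \<le> \<rho> \<le> L\<close>. This is where the extra logarithm is gained.
\<close>
lemma space_conv_ge_log_power:
  assumes ex: "space_conv_exists V2 (\<lambda>z. (w z)\<^sup>2) y"
    and s: "1 \<le> L" "L \<le> s" "norm y \<le> 2 * s" and a: "0 \<le> a"
    and w: "\<And>z. s + 1 \<le> norm z \<Longrightarrow> norm z \<le> s + L \<Longrightarrow>
      a * (ln (norm z - s)) ^ p \<le> norm z * sqrt (norm z - s) * w z"
  shows "a\<^sup>2 * pi * (ln L) ^ (2 * p + 1) / (4 * s\<^sup>2 * real (2 * p + 1)) \<le> space_conv V2 (\<lambda>z. (w z)\<^sup>2) y"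
proof -
  define c where "c = a\<^sup>2 / (16 * s\<^sup>2)"
  have c: "c \<ge> 0" by (simp add: c_def)
  define k where "k l = c * (ln (l - s)) ^ (2 * p) / (l\<^sup>2 * (l - s)) * indicator {s + 1..s + L} l"
    for l :: real
  have [measurable]: "k \<in> borel_measurable borel" unfolding k_def by measurable
  \<comment> \<open>The point \<open>z = y\<close> is excluded because \<open>V2 0 = 0\<close> breaks the bound there.\<close>
  have AE: "AE z in lborel. ennreal (k (norm z)) \<le> ennreal (V2 (y - z) * (w z)\<^sup>2)"
    using AE_lborel_singleton[of y]
  proof eventually_elim
    case (elim z)
    show ?case
    proof (intro ennreal_leI, cases "norm z \<in> {s + 1..s + L}")
      case False
      then show "k (norm z) \<le> V2 (y - z) * (w z)\<^sup>2" by (simp add: k_def V2_def)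
    next
      case True
      define l where "l = norm z"
      have l: "s + 1 \<le> l" "l \<le> s + L" using True by (simp_all add: l_def)
      have ln: "0 \<le> ln (l - s)" using l by simp
      have "0 < norm (y - z)" using elim by simp
      moreover have "norm (y - z) \<le> 4 * s"
        using norm_triangle_ineq4[of y z] s l by (simp add: l_def)
      moreover have "0 < s" using s by simp
      ultimately have V: "1 / (16 * s\<^sup>2) \<le> V2 (y - z)"
        unfolding V2_def using power_mono[of "norm (y - z)" "4 * s" 2]
        by (intro divide_left_mono) (auto simp: power_mult_distrib)
      have "0 \<le> a * (ln (l - s)) ^ p" using a ln by simp
      from power_mono[OF w this[unfolded l_def], of 2] l
      have "(a * (ln (l - s)) ^ p)\<^sup>2 \<le> (l * sqrt (l - s) * w z)\<^sup>2" by (simp add: l_def)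
      also have "(l * sqrt (l - s) * w z)\<^sup>2 = l\<^sup>2 * (l - s) * (w z)\<^sup>2"
        using l by (simp add: power_mult_distrib)
      finally have "(a * (ln (l - s)) ^ p)\<^sup>2 / (l\<^sup>2 * (l - s)) \<le> (w z)\<^sup>2"
        using l s by (simp add: divide_le_eq mult.commute)
      then have "1 / (16 * s\<^sup>2) * ((a * (ln (l - s)) ^ p)\<^sup>2 / (l\<^sup>2 * (l - s))) \<le> V2 (y - z) * (w z)\<^sup>2"
        using V l s by (intro mult_mono) (auto simp: V2_def)
      then show "k (norm z) \<le> V2 (y - z) * (w z)\<^sup>2"
        using True by (simp add: k_def c_def l_def power_mult_distrib power_mult[symmetric] mult.commute)
    qed
  qed
  have deriv: "((\<lambda>l. 4 * pi * c * ((ln (l - s)) ^ (2 * p + 1) / real (2 * p + 1)))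
      has_real_derivative 4 * pi * c * ((ln (l - s)) ^ (2 * p) / (l - s))) (at l)"
    if "s + 1 \<le> l" for l
  proof -
    have "((\<lambda>l. ln (l - s)) has_real_derivative 1 / (l - s)) (at l)"
      using that by (auto intro!: derivative_eq_intros)
    from DERIV_cmult[OF DERIV_cdivide[OF DERIV_power[OF this, of "2 * p + 1"], of "real (2 * p + 1)"],
        of "4 * pi * c"]
    show ?thesis by (simp del: of_nat_add of_nat_mult of_nat_Suc)
  qed
  have "ennreal (4 * pi * c * ((ln (s + L - s)) ^ (2 * p + 1) / real (2 * p + 1))
      - 4 * pi * c * ((ln (s + 1 - s)) ^ (2 * p + 1) / real (2 * p + 1)))
    = (\<integral>\<^sup>+l. ennreal (4 * pi * c * ((ln (l - s)) ^ (2 * p) / (l - s))) * indicator {s + 1..s + L} l \<partial>lborel)"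
    using s c
    by (intro nn_integral_FTC_Icc[symmetric] deriv[THEN has_field_derivative_at_within]) auto
  also have "\<dots> = (\<integral>\<^sup>+l. ennreal (4 * pi * l\<^sup>2) * indicator {0..} l * ennreal (k l) \<partial>lborel)"
  proof (intro nn_integral_cong)
    fix l :: real
    show "ennreal (4 * pi * c * ((ln (l - s)) ^ (2 * p) / (l - s))) * indicator {s + 1..s + L} l
        = ennreal (4 * pi * l\<^sup>2) * indicator {0..} l * ennreal (k l)"
    proof (cases "l \<in> {s + 1..s + L}")
      case True
      then have "0 < l" using s by simp
      then have "4 * pi * l\<^sup>2 * k l = 4 * pi * c * ((ln (l - s)) ^ (2 * p) / (l - s))"
        using True by (simp add: k_def)
      then show ?thesis using True \<open>0 < l\<close> by (simp add: ennreal_mult'[symmetric])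
    qed (simp add: k_def)
  qed
  also have "\<dots> = (\<integral>\<^sup>+z. ennreal (k (norm z)) \<partial>(lborel :: (real^3) measure))"
    by (rule nn_integral_radial[symmetric]) simp
  also have "\<dots> \<le> (\<integral>\<^sup>+z. ennreal (V2 (y - z) * (w z)\<^sup>2) \<partial>lborel)"
    by (rule nn_integral_mono_AE[OF AE])
  also have "\<dots> = ennreal (space_conv V2 (\<lambda>z. (w z)\<^sup>2) y)"
    unfolding space_conv_def using ex
    by (intro nn_integral_eq_integral) (auto simp: space_conv_exists_def V2_def)
  finally have "4 * pi * c * ((ln L) ^ (2 * p + 1) / real (2 * p + 1)) \<le> space_conv V2 (\<lambda>z. (w z)\<^sup>2) y"
    by (subst (asm) ennreal_le_iff)
      (auto simp: space_conv_def V2_def intro!: Bochner_Integration.integral_nonneg)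
  moreover have "4 * pi * c * (X / n) = a\<^sup>2 * pi * X / (4 * s\<^sup>2 * n)" for X n :: real
    by (simp add: c_def)
  ultimately show ?thesis by (simp only:)
qed

section \<open>Iteration of the lower bound\<close>

lemma is_solution_nonneg_exterior:
  assumes sol: "is_solution (\<lambda>x. 0) g T u"
    and pos: "\<And>x. 1 \<le> norm x \<Longrightarrow> 0 < g x"
    and t: "0 \<le> t" "ennreal t < T" and x: "t + 1 \<le> norm x"
  shows "0 \<le> u x t"
proof (cases "t = 0")
  case True
  then show ?thesis
    using is_solution_integral_equation[OF sol t, of x] by (simp add: wave_W_def wave_L_def)
next
  case False
  then show ?thesis using is_solution_pos_exterior[OF sol pos, of t x] t x by simp
qed

text \<open>
  On the part of the sphere with \<open>\<rho> \<le> |y| \<le> 2 \<rho>\<close> the data are at least of size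
  \<open>\<beta> \<rho>\<^bsup>-5/2\<^esup> / 16\<close>.
\<close>
lemma wave_W_data_ge:
  assumes cont: "continuous_on UNIV g" and \<beta>: "0 \<le> \<beta>"
    and g: "\<And>x. 1 \<le> norm x \<Longrightarrow> \<beta> / (1 + norm x) powr (5/2) \<le> g x"
    and \<rho>: "1 \<le> norm x - t" "2 * (norm x - t) \<le> t"
  shows "\<beta> / 32 \<le> norm x * sqrt (norm x - t) * wave_W g x t"
proof -
  define \<rho> where "\<rho> = norm x - t"
  have r: "1 \<le> \<rho>" "2 * \<rho> \<le> t" "norm x = t + \<rho>" using \<rho> by (simp_all add: \<rho>_def)
  have norm_ge: "\<rho> \<le> norm y" if "dist x y = t" for y
    using norm_triangle_ineq2[of x y] that by (simp add: dist_norm \<rho>_def)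
  define m where "m = \<beta> / (16 * \<rho>\<^sup>2 * sqrt \<rho>)"
  have m: "0 \<le> m" using r \<beta> by (simp add: m_def)
  have m_le: "m \<le> g y" if "\<rho> \<le> norm y" "norm y \<le> 2 * \<rho>" for y
  proof -
    have "sqrt 3 \<le> 16 / 9" by (rule real_le_lsqrt) (simp_all add: power2_eq_square)
    have "(1 + norm y) powr (5/2) \<le> (3 * \<rho>) powr (5/2)"
      using that r by (intro powr_mono2) auto
    also have "\<dots> = (3 * \<rho>) powr (2 + 1/2)" by simp
    also have "\<dots> = (3 * \<rho>)\<^sup>2 * sqrt (3 * \<rho>)"
      using r by (subst powr_add) (simp add: powr_half_sqrt powr_numeral)
    also have "\<dots> = sqrt 3 * (9 * \<rho>\<^sup>2 * sqrt \<rho>)" by (simp add: real_sqrt_mult power_mult_distrib)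
    also have "\<dots> \<le> 16 / 9 * (9 * \<rho>\<^sup>2 * sqrt \<rho>)"
      using \<open>sqrt 3 \<le> 16 / 9\<close> r by (intro mult_right_mono) auto
    finally have "(1 + norm y) powr (5/2) \<le> 16 * \<rho>\<^sup>2 * sqrt \<rho>" by (simp add: mult_ac)
    from divide_left_mono[OF this \<beta>] have "m \<le> \<beta> / (1 + norm y) powr (5/2)"
      using r that by (simp add: m_def)
    also have "\<dots> \<le> g y" using that r by (intro g) auto
    finally show ?thesis .
  qed
  have "m * ((2 * \<rho>)\<^sup>2 - \<rho>\<^sup>2) / 6 \<le> norm x * wave_W g x t"
  proof (rule wave_W_ge_shell[OF _ _ continuous_on_subset[OF cont]])
    fix y assume "dist x y = t"
    then have y: "1 \<le> norm y" using norm_ge r by force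
    have "0 \<le> \<beta> / (1 + norm y) powr (5/2)" using \<beta> by simp
    then show "0 \<le> g y" using g[OF y] by linarith
  qed (use r m m_le in auto)
  then have "sqrt \<rho> * (m * \<rho>\<^sup>2 / 2) \<le> sqrt \<rho> * (norm x * wave_W g x t)"
    using r by (intro mult_left_mono) (auto simp: power_mult_distrib)
  also have "sqrt \<rho> * (m * \<rho>\<^sup>2 / 2) = \<beta> / 32"
    using r by (simp add: m_def)
  finally show ?thesis by (simp add: \<rho>_def mult_ac)
qed

text \<open>
  The source is bounded from below for times \<open>s\<close> in a window of length \<open>\<delta> \<rho>\<close> that starts at
  \<open>\<sigma> (1 + \<delta>) \<rho>\<close>, and on shells \<open>\<rho> \<le> |y| - s \<le> (1 + \<delta>) \<rho>\<close>. There the hypothesis is available for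
  \<open>u(y, s)\<close>, and also for all \<open>u(z, s)\<close> with \<open>1 \<le> |z| - s \<le> \<rho>\<close>, which produce the potential. The condition
  on \<open>\<sigma>'\<close> ensures that the sphere of radius \<open>t - s\<close> around \<open>x\<close> crosses the whole shell. Window
  and shell contribute one factor \<open>\<delta>\<close> each.
\<close>
lemma exterior_bound_step:
  assumes sol: "is_solution (\<lambda>x. 0) g T u"
    and pos: "\<And>x. 1 \<le> norm x \<Longrightarrow> 0 < g x"
    and a: "0 \<le> a"
    and lower: "\<And>y s. 0 \<le> s \<Longrightarrow> ennreal s < T \<Longrightarrow> 1 \<le> norm y - s \<Longrightarrow> \<sigma> * (norm y - s) \<le> s \<Longrightarrow>
      a * ln (norm y - s) ^ p \<le> norm y * sqrt (norm y - s) * u y s"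
    and \<sigma>: "2 \<le> \<sigma>" "0 < \<delta>" "\<delta> \<le> 1" "\<sigma> * (1 + \<delta>) + 3 / 2 * \<delta> \<le> \<sigma>'" "\<sigma>' \<le> 3"
    and t: "0 \<le> t" "ennreal t < T" and \<rho>: "1 \<le> norm x - t" "\<sigma>' * (norm x - t) \<le> t"
  shows "\<delta>\<^sup>2 * a ^ 3 * ln (norm x - t) ^ (3 * p + 1) / (144 * real (2 * p + 1))
    \<le> norm x * sqrt (norm x - t) * u x t"
proof -
  define \<rho> where "\<rho> = norm x - t"
  have r: "1 \<le> \<rho>" "\<sigma>' * \<rho> \<le> t" "norm x = t + \<rho>" using \<rho> by (simp_all add: \<rho>_def)
  have ln: "0 \<le> ln \<rho>" using r by simp
  have T: "ennreal s < T" if "s \<le> t" for s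
    using ennreal_leI[OF that] t(2) by (rule le_less_trans)
  note contN = is_solution_continuous(2)[OF sol t(2)]
  have norm_ge: "s + \<rho> \<le> norm y" if "dist x y = t - s" for y s
    using norm_triangle_ineq2[of x y] that by (simp add: dist_norm \<rho>_def)
  have nonneg: "0 \<le> nonlinearity u y s" if "0 \<le> s" "s \<le> t" "dist x y = t - s" for y s
    using that norm_ge[OF that(3)] r T
    by (intro nonlinearity_nonneg is_solution_nonneg_exterior[OF sol pos]) auto
  define s1 where "s1 = \<sigma> * (1 + \<delta>) * \<rho>"
  define s2 where "s2 = s1 + \<delta> * \<rho>"
  have s1: "2 * \<rho> \<le> s1" "\<sigma> * \<rho> \<le> s1"
  proof -
    have "2 * 1 \<le> \<sigma> * (1 + \<delta>)" "\<sigma> * 1 \<le> \<sigma> * (1 + \<delta>)"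
      using \<sigma> by (intro mult_mono; simp)+
    then show "2 * \<rho> \<le> s1" "\<sigma> * \<rho> \<le> s1"
      unfolding s1_def using r by (intro mult_right_mono; simp)+
  qed
  have \<delta>\<rho>: "0 < \<delta> * \<rho>" "\<delta> * \<rho> \<le> \<rho>" using \<sigma> r by auto
  have "(\<sigma> * (1 + \<delta>) + 3 / 2 * \<delta>) * \<rho> \<le> \<sigma>' * \<rho>" using \<sigma> r by (intro mult_right_mono) auto
  then have s2_le: "s2 + \<delta> * \<rho> / 2 \<le> \<sigma>' * \<rho>" by (simp add: s1_def s2_def algebra_simps)
  then have s2: "s2 + \<delta> * \<rho> / 2 \<le> t" using r by simp
  have "\<sigma>' * \<rho> \<le> 3 * \<rho>" using \<sigma> r by (intro mult_right_mono) auto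
  then have s2_3: "s2 \<le> 3 * \<rho>" using s2_le \<delta>\<rho> by linarith
  define q where "q = real (2 * p + 1)"
  have q: "q > 0" by (simp add: q_def)
  define k where "k = a\<^sup>2 * ln \<rho> ^ (2 * p + 1) / (12 * \<rho>\<^sup>2 * q)"
  define v where "v = a * ln \<rho> ^ p / (12 * \<rho> * sqrt \<rho>)"
  have kv: "0 \<le> k" "0 \<le> v" using a ln r q by (simp_all add: k_def v_def)
  have window: "k * v * (\<delta> * \<rho>\<^sup>2) / norm x \<le> wave_W (\<lambda>y. nonlinearity u y s) x (t - s)"
    if s: "s1 \<le> s" "s \<le> s2" for s
  proof -
    have s_le: "2 * \<rho> \<le> s" "\<sigma> * \<rho> \<le> s" "s \<le> 3 * \<rho>" "0 < t - s" "s \<le> t" "0 \<le> s"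
      using s s1 s2 s2_3 \<delta>\<rho> r by auto
    have "k * v * ((s + (1 + \<delta>) * \<rho>)\<^sup>2 - (s + \<rho>)\<^sup>2) / 6
        \<le> norm x * wave_W (\<lambda>y. nonlinearity u y s) x (t - s)"
    proof (rule wave_W_ge_shell)
      show "0 < t - s" "t - s < norm x" "norm x - (t - s) \<le> s + \<rho>" "s + \<rho> < s + (1 + \<delta>) * \<rho>"
        using s_le r \<delta>\<rho> by (auto simp: algebra_simps)
      show "s + (1 + \<delta>) * \<rho> \<le> norm x + (t - s)"
        using s s2 r by (simp add: algebra_simps)
      show "continuous_on (sphere x (t - s)) (\<lambda>y. nonlinearity u y s)"
        using s_le by (intro continuous_on_compose2[OF contN, of _ "\<lambda>y. (y, s)", simplified] continuous_intros) auto
      show "0 \<le> nonlinearity u y s" if "dist x y = t - s" for y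
        using nonneg that s_le by simp
      show "0 \<le> k * v" using kv by simp
    next
      fix y assume y: "dist x y = t - s" "s + \<rho> \<le> norm y" "norm y \<le> s + (1 + \<delta>) * \<rho>"
      define \<alpha> where "\<alpha> = norm y - s"
      have \<alpha>: "\<rho> \<le> \<alpha>" "\<alpha> \<le> (1 + \<delta>) * \<rho>" "norm y = s + \<alpha>" using y by (simp_all add: \<alpha>_def)
      then have \<alpha>2: "\<alpha> \<le> 2 * \<rho>" using \<delta>\<rho> by (simp add: algebra_simps)
      have "\<sigma> * \<alpha> \<le> \<sigma> * ((1 + \<delta>) * \<rho>)" using \<alpha> \<sigma> by (intro mult_left_mono) auto
      then have \<sigma>\<alpha>: "\<sigma> * \<alpha> \<le> s" using s by (simp add: s1_def mult.assoc)
      have "a * ln \<rho> ^ p \<le> a * ln \<alpha> ^ p"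
        using a ln r \<alpha> by (intro mult_left_mono power_mono) auto
      also have "\<dots> \<le> norm y * sqrt \<alpha> * u y s"
        using lower[of s y, folded \<alpha>_def] s_le T[of s] \<alpha>(1) r(1) \<sigma>\<alpha> by simp
      also have "\<dots> \<le> (6 * \<rho>) * (2 * sqrt \<rho>) * u y s"
      proof (intro mult_right_mono mult_mono)
        show "sqrt \<alpha> \<le> 2 * sqrt \<rho>"
          using \<alpha>2 r real_sqrt_le_mono[of \<alpha> "4 * \<rho>"] by (simp add: real_sqrt_mult)
        show "0 \<le> u y s"
          using s_le T \<alpha> r by (intro is_solution_nonneg_exterior[OF sol pos]) auto
      qed (use s_le \<alpha> \<alpha>2 r in auto)
      finally have u: "v \<le> u y s" unfolding v_def using r by (simp add: divide_le_eq mult_ac)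
      have "k \<le> a\<^sup>2 * pi * ln \<rho> ^ (2 * p + 1) / (4 * s\<^sup>2 * q)"
      proof -
        have "s\<^sup>2 \<le> (3 * \<rho>)\<^sup>2" using s_le by (intro power_mono) auto
        then have den: "4 * s\<^sup>2 * q \<le> 36 * \<rho>\<^sup>2 * q"
          using q by (intro mult_right_mono) (auto simp: power_mult_distrib)
        define A where "A = a\<^sup>2 * ln \<rho> ^ (2 * p + 1)"
        have "0 \<le> A" using ln by (simp add: A_def)
        then have "A * 3 / (36 * \<rho>\<^sup>2 * q) \<le> A * pi / (4 * s\<^sup>2 * q)"
          using q s_le r pi_gt3 den by (intro frac_le mult_left_mono) auto
        then show ?thesis by (simp add: k_def A_def mult_ac)
      qed
      also have "\<dots> \<le> space_conv V2 (\<lambda>z. (u z s)\<^sup>2) y"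
        unfolding q_def
      proof (rule space_conv_ge_log_power[OF _ r(1) _ _ a])
        show "space_conv_exists V2 (\<lambda>z. (u z s)\<^sup>2) y"
          using sol s_le T by (auto simp: is_solution_def time_slab_def)
        fix z :: "real^3" assume z: "s + 1 \<le> norm z" "norm z \<le> s + \<rho>"
        have "\<sigma> * (norm z - s) \<le> \<sigma> * \<rho>" using z \<sigma> by (intro mult_left_mono) auto
        then show "a * ln (norm z - s) ^ p \<le> norm z * sqrt (norm z - s) * u z s"
          using lower[of s z] s_le T[of s] z by simp
      qed (use s_le r \<alpha> \<alpha>2 in auto)
      finally show "k * v \<le> nonlinearity u y s"
        unfolding nonlinearity_def using u kv by (intro mult_mono) auto
    qed
    moreover have "6 * (\<delta> * \<rho>\<^sup>2) \<le> (s + (1 + \<delta>) * \<rho>)\<^sup>2 - (s + \<rho>)\<^sup>2"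
    proof -
      have "(s + (1 + \<delta>) * \<rho>)\<^sup>2 - (s + \<rho>)\<^sup>2 = \<delta> * \<rho> * (2 * s + 2 * \<rho> + \<delta> * \<rho>)"
        by (simp add: power2_eq_square algebra_simps)
      also have "\<dots> \<ge> \<delta> * \<rho> * (6 * \<rho>)"
        using \<delta>\<rho> s_le by (intro mult_left_mono) auto
      finally show ?thesis by (simp add: power2_eq_square mult_ac)
    qed
    then have "k * v * (6 * (\<delta> * \<rho>\<^sup>2)) / 6 \<le> k * v * ((s + (1 + \<delta>) * \<rho>)\<^sup>2 - (s + \<rho>)\<^sup>2) / 6"
      using kv by (intro divide_right_mono mult_left_mono) auto
    ultimately have "k * v * (\<delta> * \<rho>\<^sup>2) \<le> norm x * wave_W (\<lambda>y. nonlinearity u y s) x (t - s)"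
      by simp
    then show ?thesis using r t by (simp add: divide_le_eq mult.commute)
  qed
  have "k * v * (\<delta> * \<rho>\<^sup>2) / norm x * (s2 - s1) \<le> wave_L (nonlinearity u) x t"
    using nonneg window s1 s2 \<delta>\<rho> r
    by (intro wave_L_ge_window[OF contN]) (auto simp: s2_def)
  moreover have "0 \<le> wave_W g x t"
  proof (rule wave_W_nonneg[OF t(1)])
    fix y assume "dist x y = t"
    then show "0 \<le> g y" using norm_ge[of y 0] r pos[of y] by simp
  qed
  ultimately have "k * v * (\<delta> * \<rho>\<^sup>2) / norm x * (s2 - s1) \<le> u x t"
    unfolding is_solution_integral_equation[OF sol t] by linarith
  then have "norm x * sqrt \<rho> * (k * v * (\<delta> * \<rho>\<^sup>2) / norm x * (s2 - s1)) \<le> norm x * sqrt \<rho> * u x t"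
    using r t by (intro mult_left_mono) auto
  also have "norm x * sqrt \<rho> * (k * v * (\<delta> * \<rho>\<^sup>2) / norm x * (s2 - s1))
      = \<delta>\<^sup>2 * \<rho> ^ 3 * sqrt \<rho> * (k * v)"
    using r t by (simp add: s2_def power2_eq_square power3_eq_cube mult_ac)
  also have "k * v = a ^ 3 * ln \<rho> ^ (3 * p + 1) / (144 * q * \<rho> ^ 3 * sqrt \<rho>)"
  proof -
    have "3 * p + 1 = (2 * p + 1) + p" by simp
    then have exponent: "ln \<rho> ^ (3 * p + 1) = ln \<rho> ^ (2 * p + 1) * ln \<rho> ^ p" by (simp only: power_add)
    show ?thesis
      unfolding k_def v_def exponent by (simp add: power2_eq_square power3_eq_cube mult_ac)
  qed
  also have "\<delta>\<^sup>2 * \<rho> ^ 3 * sqrt \<rho> * (a ^ 3 * ln \<rho> ^ (3 * p + 1) / (144 * q * \<rho> ^ 3 * sqrt \<rho>))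
      = \<delta>\<^sup>2 * a ^ 3 * ln \<rho> ^ (3 * p + 1) / (144 * q)"
    using r by simp
  finally show ?thesis by (simp only: \<rho>_def q_def)
qed

primrec log_exponent :: "nat \<Rightarrow> nat" where
  "log_exponent 0 = 0"
| "log_exponent (Suc n) = 3 * log_exponent n + 1"

lemma log_exponent_eq: "2 * log_exponent n + 1 = 3 ^ n"
  by (induction n) auto

text \<open>
  The coefficients solve the recursion of the step exactly up to \<open>12\<^bsup>n\<^esup> \<le> 16\<^bsup>n\<^esup>\<close>: with
  \<open>\<delta> = 2\<^bsup>-n\<^esup> / 16\<close> one has \<open>\<delta>\<^sup>2 / 144 = 4\<^bsup>-n\<^esup> / 192\<^sup>2\<close>, and \<open>G = 384\<close> is the root of
  \<open>G\<^sup>3 / 192\<^sup>2 = 4 G\<close>. The constant \<open>12288 = 32 * 384\<close> makes the free wave satisfy the case \<open>n = 0\<close>.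
\<close>
lemma exterior_bound:
  assumes sol: "is_solution (\<lambda>x. 0) g T u"
    and \<xi>: "0 < \<xi>"
    and g: "\<And>x. 1 \<le> norm x \<Longrightarrow> 12288 * \<xi> / (1 + norm x) powr (5/2) \<le> g x"
    and t: "0 \<le> t" "ennreal t < T"
    and \<rho>: "1 \<le> norm x - t" "(3 - 1 / 2 ^ n) * (norm x - t) \<le> t"
  shows "384 * 4 ^ n * \<xi> * (\<xi>\<^sup>2 * ln (norm x - t)) ^ log_exponent n
    \<le> norm x * sqrt (norm x - t) * u x t"
  using t \<rho>
proof (induction n arbitrary: x t)
  case 0
  have pos: "0 < g x" if "1 \<le> norm x" for x
    using less_le_trans[OF _ g[OF that]] \<xi> that by simp
  have contN: "continuous_on (UNIV \<times> {0..t}) (\<lambda>(y, s). nonlinearity u y s)"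
    using is_solution_continuous(2)[OF sol] 0 by blast
  have "0 \<le> 0 * t\<^sup>2 / 2" by simp
  also have "\<dots> \<le> wave_L (nonlinearity u) x t"
  proof (rule wave_L_ge[OF contN 0(1)])
    fix s y assume s: "0 \<le> s" "s < t" "dist x y = t - s"
    have "s + 1 \<le> norm y"
      using norm_triangle_ineq2[of x y] s 0 by (simp add: dist_norm)
    moreover have "ennreal s < T"
      using ennreal_leI[of s t] s 0 by (meson le_less_trans less_imp_le)
    ultimately show "0 \<le> nonlinearity u y s"
      using s by (intro nonlinearity_nonneg is_solution_nonneg_exterior[OF sol pos])
  qed
  finally have u: "wave_W g x t \<le> u x t"
    using is_solution_integral_equation[OF sol 0(1,2), of x] by simp
  have "12288 * \<xi> / 32 \<le> norm x * sqrt (norm x - t) * wave_W g x t"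
    using sol \<xi> 0 by (intro wave_W_data_ge g) (auto simp: is_solution_def)
  also have "\<dots> \<le> norm x * sqrt (norm x - t) * u x t"
    using u 0 by (intro mult_left_mono) auto
  finally show ?case by simp
next
  case (Suc n)
  have pos: "0 < g x" if "1 \<le> norm x" for x
    using less_le_trans[OF _ g[OF that]] \<xi> that by simp
  define p where "p = log_exponent n"
  define a where "a = 384 * 4 ^ n * \<xi> * (\<xi>\<^sup>2) ^ p"
  define \<delta> :: real where "\<delta> = 1 / 2 ^ n / 16"
  have \<delta>: "0 < \<delta>" "\<delta> \<le> 1 / 16" by (simp_all add: \<delta>_def)
  have step: "\<delta>\<^sup>2 * a ^ 3 * ln (norm x - t) ^ (3 * p + 1) / (144 * real (2 * p + 1))
    \<le> norm x * sqrt (norm x - t) * u x t"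
  proof (rule exterior_bound_step[OF sol pos])
    show "0 \<le> a" using \<xi> by (simp add: a_def)
    show "2 \<le> 3 - 1 / (2::real) ^ n" "3 - 1 / 2 ^ Suc n \<le> (3::real)" by simp_all
    \<comment> \<open>\<open>16 \<delta>\<close> is the distance of \<open>3 - 1 / 2 ^ n\<close> from \<open>3\<close>, and the step needs less than half of it.\<close>
    show "(3 - 1 / 2 ^ n) * (1 + \<delta>) + 3 / 2 * \<delta> \<le> 3 - 1 / 2 ^ Suc n"
    proof -
      have "(3 - 16 * \<delta>) * (1 + \<delta>) + 3 / 2 * \<delta> = 3 - 16 * \<delta> + 9 / 2 * \<delta> - 16 * \<delta> * \<delta>"
        by (simp add: algebra_simps)
      also have "\<dots> \<le> 3 - 8 * \<delta>" using \<delta> mult_pos_pos[OF \<delta>(1) \<delta>(1)] by linarith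
      finally show ?thesis by (simp add: \<delta>_def)
    qed
    fix y :: "real^3" and s :: real
    assume "0 \<le> s" "ennreal s < T" "1 \<le> norm y - s" "(3 - 1 / 2 ^ n) * (norm y - s) \<le> s"
    from Suc.IH[OF this] show "a * ln (norm y - s) ^ p \<le> norm y * sqrt (norm y - s) * u y s"
      by (simp add: a_def p_def power_mult_distrib mult_ac)
  qed (use Suc.prems \<delta> in auto)
  have ln: "0 \<le> ln (norm x - t)" using Suc.prems by simp
  have "384 * 4 ^ Suc n * \<xi> * (\<xi>\<^sup>2 * ln (norm x - t)) ^ log_exponent (Suc n)
      \<le> \<delta>\<^sup>2 * a ^ 3 * ln (norm x - t) ^ (3 * p + 1) / (144 * real (2 * p + 1))"
  proof -
    have q: "real (2 * p + 1) = 3 ^ n" unfolding p_def log_exponent_eq by simp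
    have \<delta>2: "\<delta>\<^sup>2 = 1 / (256 * 4 ^ n)"
      by (simp add: \<delta>_def power_divide power_mult_distrib power2_eq_square flip: power_mult_distrib)
    have a3: "a ^ 3 = 384 ^ 3 * 64 ^ n * \<xi> * (\<xi>\<^sup>2) ^ (3 * p + 1)"
    proof -
      have cube: "(y ^ i) ^ 3 = (y ^ 3) ^ i" for y :: real and i
        by (simp only: power_mult[symmetric] mult.commute)
      have "a ^ 3 = 384 ^ 3 * (4 ^ n) ^ 3 * \<xi> ^ 3 * ((\<xi>\<^sup>2) ^ p) ^ 3"
        by (simp only: a_def power_mult_distrib)
      also have "\<dots> = 384 ^ 3 * (4 ^ 3) ^ n * (\<xi> * \<xi>\<^sup>2) * (\<xi>\<^sup>2) ^ (3 * p)"
        unfolding cube by (simp only: power_mult power2_eq_square power3_eq_cube mult.assoc)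
      also have "\<dots> = 384 ^ 3 * 64 ^ n * \<xi> * (\<xi>\<^sup>2) ^ (3 * p + 1)"
        by (simp only: power_add power_one_right) simp
      finally show ?thesis .
    qed
    define E where "E = \<xi> * ((\<xi>\<^sup>2) ^ (3 * p + 1) * ln (norm x - t) ^ (3 * p + 1))"
    have E: "0 \<le> E" using \<xi> ln by (simp add: E_def)
    have "(64::real) ^ n = 16 ^ n * 4 ^ n" by (simp flip: power_mult_distrib)
    then have "\<delta>\<^sup>2 * a ^ 3 * ln (norm x - t) ^ (3 * p + 1) / (144 * real (2 * p + 1))
        = 1536 * (16 ^ n / 3 ^ n) * E"
      unfolding q \<delta>2 a3 E_def by simp
    moreover have "(4::real) ^ n \<le> 16 ^ n / 3 ^ n"
    proof -
      have "(4::real) ^ n * 3 ^ n \<le> 16 ^ n" unfolding power_mult_distrib[symmetric] by (intro power_mono) auto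
      then show ?thesis by (simp add: le_divide_eq)
    qed
    then have "1536 * 4 ^ n * E \<le> 1536 * (16 ^ n / 3 ^ n) * E"
      using E by (intro mult_right_mono mult_left_mono) auto
    moreover have "384 * 4 ^ Suc n * \<xi> * (\<xi>\<^sup>2 * ln (norm x - t)) ^ log_exponent (Suc n) = 1536 * 4 ^ n * E"
      unfolding E_def p_def[symmetric] log_exponent.simps power_mult_distrib by simp
    ultimately show ?thesis by linarith
  qed
  then show ?case using step by linarith
qed

text \<open>
  At \<open>\<rho> = exp (1 / \<xi>\<^sup>2)\<close> the factor \<open>(\<xi>\<^sup>2 ln \<rho>)\<^bsup>p\<^esup>\<close> equals \<open>1\<close> for every exponent, and the factor
  \<open>4\<^bsup>n\<^esup>\<close> is left.
\<close>
lemma no_solution_beyond: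
  assumes sol: "is_solution (\<lambda>x. 0) g T u"
    and \<xi>: "0 < \<xi>"
    and g: "\<And>x. 1 \<le> norm x \<Longrightarrow> 12288 * \<xi> / (1 + norm x) powr (5/2) \<le> g x"
  shows "T \<le> ennreal (3 * exp (1 / \<xi>\<^sup>2))"
proof (rule ccontr)
  define \<rho> where "\<rho> = exp (1 / \<xi>\<^sup>2)"
  have \<rho>: "1 \<le> \<rho>" "\<xi>\<^sup>2 * ln \<rho> = 1" using \<xi> by (simp_all add: \<rho>_def)
  assume "\<not> T \<le> ennreal (3 * exp (1 / \<xi>\<^sup>2))"
  then have T: "ennreal (3 * \<rho>) < T" by (simp add: \<rho>_def)
  define x :: "real^3" where "x = (4 * \<rho>) *\<^sub>R axis 1 1"
  have x: "norm x - 3 * \<rho> = \<rho>" using \<rho> by (simp add: x_def)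
  have bound: "384 * \<xi> * 4 ^ n \<le> norm x * sqrt \<rho> * u x (3 * \<rho>)" for n
  proof -
    have "(3 - 1 / 2 ^ n) * \<rho> \<le> 3 * \<rho>" using \<rho> by (intro mult_right_mono) auto
    then show ?thesis
      using exterior_bound[OF sol \<xi> g _ T, of x n] \<rho> unfolding x by (simp add: mult_ac)
  qed
  obtain n where "norm x * sqrt \<rho> * u x (3 * \<rho>) / (384 * \<xi>) < 4 ^ n"
    using real_arch_pow[of 4] by auto
  then show False using bound[of n] \<xi> by (simp add: divide_less_eq mult_ac)
qed

theorem theorem1p2:
  fixes u1 :: "real^3 \<Rightarrow> real" and B :: real
  assumes "continuous_on UNIV u1"
    and "B > 0"
    and "\<And>x. norm x \<ge> 1 \<Longrightarrow> u1 x \<ge> B / (1 + norm x) powr (5/2)"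
  shows "\<exists>C>0. \<exists>\<epsilon>0>0. \<forall>\<epsilon>. 0 < \<epsilon> \<and> \<epsilon> \<le> \<epsilon>0 \<longrightarrow>
           lifespan (\<lambda>x. 0) (\<lambda>x. \<epsilon> * u1 x) \<le> ennreal (exp (C * \<epsilon> powr (-2)))"
proof -
  define C where "C = (12288 / B)\<^sup>2 + 2"
  have "lifespan (\<lambda>x. 0) (\<lambda>x. \<epsilon> * u1 x) \<le> ennreal (exp (C * \<epsilon> powr (-2)))"
    if \<epsilon>: "0 < \<epsilon>" "\<epsilon> \<le> 1" for \<epsilon>
    unfolding lifespan_def
  proof (rule Sup_least, clarify)
    fix T assume "has_unique_solution (\<lambda>x. 0) (\<lambda>x. \<epsilon> * u1 x) T"
    then obtain u where sol: "is_solution (\<lambda>x. 0) (\<lambda>x. \<epsilon> * u1 x) T u"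
      by (auto simp: has_unique_solution_def)
    define \<xi> where "\<xi> = \<epsilon> * B / 12288"
    have \<xi>: "0 < \<xi>" using \<epsilon> assms(2) by (simp add: \<xi>_def)
    have "T \<le> ennreal (3 * exp (1 / \<xi>\<^sup>2))"
    proof (rule no_solution_beyond[OF sol \<xi>])
      fix x :: "real^3" assume "1 \<le> norm x"
      from mult_left_mono[OF assms(3)[OF this], of \<epsilon>] \<epsilon>
      show "12288 * \<xi> / (1 + norm x) powr (5/2) \<le> \<epsilon> * u1 x" by (simp add: \<xi>_def)
    qed
    also have "\<dots> \<le> ennreal (exp (C * \<epsilon> powr (-2)))"
    proof (rule ennreal_leI)
      have "3 \<le> exp (2::real)" using exp_ge_add_one_self[of 2] by simp
      \<comment> \<open>The summand \<open>2\<close> in \<open>C\<close> absorbs the factor \<open>3\<close>.\<close>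
      moreover have "2 \<le> 2 / \<epsilon>\<^sup>2" using \<epsilon> by (simp add: le_divide_eq power_le_one)
      ultimately have "3 \<le> exp (2 / \<epsilon>\<^sup>2)" by (meson exp_le_cancel_iff order_trans)
      then have "3 * exp (1 / \<xi>\<^sup>2) \<le> exp (2 / \<epsilon>\<^sup>2) * exp (1 / \<xi>\<^sup>2)" by simp
      also have "\<dots> = exp (C * \<epsilon> powr (-2))"
        using \<epsilon> by (simp add: exp_add[symmetric] C_def \<xi>_def powr_minus powr_numeral
            field_simps power_mult_distrib)
      finally show "3 * exp (1 / \<xi>\<^sup>2) \<le> exp (C * \<epsilon> powr (-2))" .
    qed
    finally show "T \<le> ennreal (exp (C * \<epsilon> powr (-2)))" .
  qed
  moreover have "C > 0" by (simp add: C_def add_nonneg_pos)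
  ultimately show ?thesis by (intro exI[of _ C] conjI exI[of _ 1]) auto
qed

end
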